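(* Let $n\geqslant 1$, let $g\colon\mathbb{R}^n\to\mathbb{R}$ be a function, and define $h\colon\mathbb{R}^n\to\mathbb{R}$ by $h=g-g(\mathbf{0})$. Then $g$ is a Lovász extension if and only if both of the following hold: (i) $h$ is comonotonic additive, i.e. $h(\mathbf{x}+\mathbf{x}')=h(\mathbf{x})+h(\mathbf{x}')$ for all comonotonic vectors $\mathbf{x},\mathbf{x}'\in\mathbb{R}^n$; (ii) $h$ is continuous, or $h$ satisfies $h(r\mathbf{x})=r\,h(\mathbf{x})$ for all $r>0$ and all $\mathbf{x}\in\mathbb{R}^n$. Moreover, $g$ is a signed Choquet integral if additionally $g(\mathbf{0})=0$.
   Context: Let $[n]=\{1,\ldots,n\}$, let $S_n$ be the symmetric group on $[n]$, and for $\pi\in S_n$ let $P_\pi=\{\mathbf{x}\in\mathbb{R}^n : x_{\pi(1)}\leqslant\cdots\leqslant x_{\pi(n)}\}$. Two vectors $\mathbf{x},\mathbf{x}'\in\mathbb{R}^n$ are comonotonic if there is $\pi\in S_n$ with $\mathbf{x},\mathbf{x}'\in P_\pi$. For $S\subseteq[n]$, $\mathbf{1}_S\in\{0,1\}^n$ denotes the characteristic vector of $S$, and $\mathbf{0}=\mathbf{1}_\varnothing$. The Lovász extension of a function $f\colon\{0,1\}^n\to\mathbb{R}$ is the continuous function $\hat f\colon\mathbb{R}^n\to\mathbb{R}$ defined on each $P_\pi$ as the unique affine function that coincides with $f$ at the $n+1$ vertices of the simplex $[0,1]^n\cap P_\pi$; explicitly, $$\hat f(\mathbf{x})=f(\mathbf{0})+\sum_{i=1}^n(f_i^\pi-f_{i+1}^\pi)\,x_{\pi(i)}\qquad(\mathbf{x}\in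 P_\pi),$$ where $f_i^\pi=f(\mathbf{1}_{\{\pi(i),\ldots,\pi(n)\}})$ for $i\in[n]$ and $f_{n+1}^\pi=f(\mathbf{0})$. A function $g\colon\mathbb{R}^n\to\mathbb{R}$ is a Lovász extension if $g=\hat f$ for some $f\colon\{0,1\}^n\to\mathbb{R}$. A signed capacity on $[n]$ is a set function $v\colon 2^{[n]}\to\mathbb{R}$ with $v(\varnothing)=0$. The signed Choquet integral with respect to $v$ is the function $C_v\colon\mathbb{R}^n\to\mathbb{R}$ given by $C_v(\mathbf{x})=\sum_{i=1}^n(v_i^{\pi}-v_{i+1}^{\pi})\,x_{\pi(i)}$ for $\mathbf{x}\in P_\pi$, where $v_i^\pi=v(\{\pi(i),\ldots,\pi(n)\})$ for $i\in[n]$ and $v_{n+1}^\pi=v(\varnothing)$. A function $g\colon\mathbb{R}^n\to\mathbb{R}$ is a signed Choquet integral if $g=C_v$ for some signed capacity $v$ on $[n]$. *)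

theory Defs
  imports "HOL-Analysis.Analysis"
begin

text \<open>
  The index set $[n]$ is an arbitrary finite type \<open>'n\<close> with \<open>n = CARD('n) \<ge> 1\<close>.  As \<open>'n\<close>
  carries no order of its own, a permutation of $[n]$ is a bijection from \<open>{1..n}\<close> onto \<open>'n\<close>;
  after composition with any fixed labelling of \<open>'n\<close> by \<open>1, \<dots>, n\<close> these are exactly the
  elements of the symmetric group.
\<close>

definition perms :: "(nat \<Rightarrow> 'n::finite) set" where
  "perms = {\<pi>. bij_betw \<pi> {1..CARD('n)} UNIV}"

definition chain_region :: "(nat \<Rightarrow> 'n::finite) \<Rightarrow> (real ^ 'n) set" where
  "chain_region \<pi> = {x. mono_on {1..CARD('n)} (\<lambda>i. x $ \<pi> i)}"

definition comonotonic :: "real ^ 'n::finite \<Rightarrow> real ^ 'n \<Rightarrow> bool" where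
  "comonotonic x x' \<longleftrightarrow> (\<exists>\<pi>\<in>perms. x \<in> chain_region \<pi> \<and> x' \<in> chain_region \<pi>)"

definition char_vec :: "'n set \<Rightarrow> real ^ 'n::finite" where
  "char_vec S = (\<chi> i. indicator S i)"

text \<open>The set $\{\pi(i),\ldots,\pi(n)\}$; it is empty for \<open>i = n + 1\<close>.\<close>

definition upper :: "(nat \<Rightarrow> 'n::finite) \<Rightarrow> nat \<Rightarrow> 'n set" where
  "upper \<pi> i = \<pi> ` {i..CARD('n)}"

text \<open>
  A function on \<open>{0,1}\<^sup>n\<close> is represented by a total function on \<open>\<real>\<^sup>n\<close>; only its values at
  characteristic vectors are used.  That the formulas on the various regions
  agree on overlaps, and that the regions cover the space, is shown below
  (\<open>lovasz_extension_eq\<close>, \<open>choquet_eq\<close>), so the definite descriptions are proper.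
\<close>

definition lovasz_extension :: "(real ^ 'n::finite \<Rightarrow> real) \<Rightarrow> real ^ 'n \<Rightarrow> real" where
  "lovasz_extension f = (THE F. \<forall>\<pi>\<in>perms. \<forall>x\<in>chain_region \<pi>. F x =
     f 0 + (\<Sum>i=1..CARD('n).
       (f (char_vec (upper \<pi> i)) - f (char_vec (upper \<pi> (i + 1)))) * x $ \<pi> i))"

definition is_lovasz_extension :: "(real ^ 'n::finite \<Rightarrow> real) \<Rightarrow> bool" where
  "is_lovasz_extension g \<longleftrightarrow> (\<exists>f. g = lovasz_extension f)"

definition signed_capacity :: "('n::finite set \<Rightarrow> real) \<Rightarrow> bool" where
  "signed_capacity v \<longleftrightarrow> v {} = 0"

definition choquet :: "('n::finite set \<Rightarrow> real) \<Rightarrow> real ^ 'n \<Rightarrow> real" where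
  "choquet v = (THE F. \<forall>\<pi>\<in>perms. \<forall>x\<in>chain_region \<pi>. F x =
     (\<Sum>i=1..CARD('n). (v (upper \<pi> i) - v (upper \<pi> (i + 1))) * x $ \<pi> i))"

definition is_signed_choquet_integral :: "(real ^ 'n::finite \<Rightarrow> real) \<Rightarrow> bool" where
  "is_signed_choquet_integral g \<longleftrightarrow> (\<exists>v. signed_capacity v \<and> g = choquet v)"

lemma chain_regions_cover: "\<exists>\<pi>\<in>perms. (x :: real ^ 'n::finite) \<in> chain_region \<pi>"
proof -
  obtain ys :: "'n list" where ys: "set ys = UNIV" "distinct ys"
    using finite_distinct_list[of "UNIV :: 'n set"] by auto
  define zs where "zs = sort_key (\<lambda>i. x $ i) ys"
  have zs: "set zs = UNIV" "distinct zs" "sorted (map (\<lambda>i. x $ i) zs)"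
    using ys by (auto simp: zs_def)
  have len: "length zs = CARD('n)"
    using distinct_card[OF zs(2)] zs(1) by simp
  define \<pi> where "\<pi> = (\<lambda>i. zs ! (i - 1))"
  have "bij_betw (\<lambda>i. i - 1) {1..CARD('n)} {..<CARD('n)}"
    by (rule bij_betw_byWitness[where f' = Suc]) auto
  moreover have "bij_betw (\<lambda>i. zs ! i) {..<CARD('n)} UNIV"
    using bij_betw_nth[OF zs(2), of "{..<CARD('n)}" UNIV] len zs(1) by simp
  ultimately have "bij_betw ((\<lambda>i. zs ! i) \<circ> (\<lambda>i. i - 1)) {1..CARD('n)} UNIV"
    by (rule bij_betw_trans)
  then have "\<pi> \<in> perms"
    by (simp add: perms_def \<pi>_def o_def)
  moreover have "x \<in> chain_region \<pi>"
    unfolding chain_region_def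
  proof (clarsimp intro!: mono_onI)
    fix r s assume a: "Suc 0 \<le> r" "r \<le> s" "s \<le> CARD('n)"
    then have "map (\<lambda>i. x $ i) zs ! (r - 1) \<le> map (\<lambda>i. x $ i) zs ! (s - 1)"
      using len by (intro sorted_nth_mono[OF zs(3)]) auto
    then show "x $ \<pi> r \<le> x $ \<pi> s"
      using a len by (simp add: \<pi>_def)
  qed
  ultimately show ?thesis by blast
qed

lemma chain_sum_eq_levels:
  fixes v :: "'n::finite set \<Rightarrow> real"
  assumes p: "\<pi> \<in> perms" and x: "x \<in> chain_region \<pi>"
  shows "(\<Sum>i=1..CARD('n). (v (upper \<pi> i) - v (upper \<pi> (i + 1))) * x $ \<pi> i) =
    (\<Sum>t\<in>range (($) x). t * (v {j. t \<le> x $ j} - v {j. t < x $ j}))"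
proof -
  let ?n = "CARD('n)"
  have bij: "bij_betw \<pi> {1..?n} UNIV"
    using p by (simp add: perms_def)
  have mono: "x $ \<pi> i \<le> x $ \<pi> j" if "1 \<le> i" "i \<le> j" "j \<le> ?n" for i j
    using mono_onD[of "{1..?n}" "\<lambda>i. x $ \<pi> i" i j] x that by (simp add: chain_region_def)
  have level: "(\<Sum>i\<in>{i\<in>{1..?n}. x $ \<pi> i = t}. (v (upper \<pi> i) - v (upper \<pi> (i + 1))) * x $ \<pi> i)
      = t * (v {j. t \<le> x $ j} - v {j. t < x $ j})" (is "?L = _") for t
  proof -
    have cut: "\<exists>a. 1 \<le> a \<and> a \<le> ?n + 1 \<and> (\<forall>i\<in>{1..?n}. P (x $ \<pi> i) \<longleftrightarrow> a \<le> i)"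
      if P: "\<And>r s. P r \<Longrightarrow> r \<le> s \<Longrightarrow> P s" for P :: "real \<Rightarrow> bool"
    proof -
      define Q where "Q i \<longleftrightarrow> 1 \<le> i \<and> (i \<le> ?n \<longrightarrow> P (x $ \<pi> i))" for i
      define a where "a = (LEAST i. Q i)"
      have Q: "Q (?n + 1)" by (simp add: Q_def)
      have Qa: "Q a" unfolding a_def by (rule LeastI[of Q, OF Q])
      have le: "a \<le> ?n + 1" unfolding a_def by (rule Least_le[of Q, OF Q])
      have "P (x $ \<pi> i) \<longleftrightarrow> a \<le> i" if i: "i \<in> {1..?n}" for i
      proof
        assume "P (x $ \<pi> i)"
        then have "Q i" using i by (simp add: Q_def)
        then show "a \<le> i" unfolding a_def by (rule Least_le)
      next
        assume ai: "a \<le> i"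
        then have "P (x $ \<pi> a)" "1 \<le> a" using Qa i by (auto simp: Q_def)
        then show "P (x $ \<pi> i)" using mono[of a i] ai i P by auto
      qed
      then show ?thesis using Qa le by (auto simp: Q_def)
    qed
    obtain a where a: "1 \<le> a" "a \<le> ?n + 1" "\<And>i. i \<in> {1..?n} \<Longrightarrow> t \<le> x $ \<pi> i \<longleftrightarrow> a \<le> i"
      using cut[of "\<lambda>r. t \<le> r"] by auto
    obtain b where b: "1 \<le> b" "b \<le> ?n + 1" "\<And>i. i \<in> {1..?n} \<Longrightarrow> t < x $ \<pi> i \<longleftrightarrow> b \<le> i"
      using cut[of "\<lambda>r. t < r"] by auto
    have ab: "a \<le> b"
    proof (cases "b \<le> ?n")
      case True
      then have "b \<in> {1..?n}" using b(1) by simp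
      then show ?thesis using a(3)[of b] b(3)[of b] by simp
    next
      case False
      then show ?thesis using a(2) by linarith
    qed
    have upper_eq: "upper \<pi> c = {j. R (x $ j)}"
      if "1 \<le> c" "\<And>i. i \<in> {1..?n} \<Longrightarrow> R (x $ \<pi> i) \<longleftrightarrow> c \<le> i" for c R
    proof (intro set_eqI iffI)
      fix j assume "j \<in> upper \<pi> c"
      then show "j \<in> {j. R (x $ j)}" using that by (auto simp: upper_def)
    next
      fix j assume j: "j \<in> {j. R (x $ j)}"
      obtain i where "i \<in> {1..?n}" "j = \<pi> i"
        using bij by (metis UNIV_I bij_betw_imp_surj_on imageE)
      then show "j \<in> upper \<pi> c" using that j by (auto simp: upper_def)
    qed
    have ua: "upper \<pi> a = {j. t \<le> x $ j}" by (rule upper_eq) (use a in auto)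
    have ub: "upper \<pi> b = {j. t < x $ j}" by (rule upper_eq) (use b in auto)
    have set_eq: "{i\<in>{1..?n}. x $ \<pi> i = t} = {a..<b}"
    proof (intro set_eqI iffI)
      fix i assume "i \<in> {i\<in>{1..?n}. x $ \<pi> i = t}"
      then show "i \<in> {a..<b}" using a(3)[of i] b(3)[of i] by auto
    next
      fix i assume i: "i \<in> {a..<b}"
      then have "i \<in> {1..?n}" using a(1) b(2) by auto
      then show "i \<in> {i\<in>{1..?n}. x $ \<pi> i = t}" using i a(3)[of i] b(3)[of i] by auto
    qed
    have "?L = (\<Sum>i\<in>{i\<in>{1..?n}. x $ \<pi> i = t}. t * (v (upper \<pi> i) - v (upper \<pi> (i + 1))))"
      by (rule sum.cong) auto
    also have "\<dots> = t * (\<Sum>i=a..<b. v (upper \<pi> i) - v (upper \<pi> (i + 1)))"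
      by (simp only: set_eq sum_distrib_left)
    also have "(\<Sum>i=a..<b. v (upper \<pi> i) - v (upper \<pi> (i + 1))) = v (upper \<pi> a) - v (upper \<pi> b)"
      using sum_Suc_diff'[OF ab, of "\<lambda>i. - v (upper \<pi> i)"] by simp
    finally show ?thesis by (simp add: ua ub)
  qed
  have "(\<Sum>i=1..?n. (v (upper \<pi> i) - v (upper \<pi> (i + 1))) * x $ \<pi> i) =
      (\<Sum>t\<in>range (($) x). \<Sum>i\<in>{i\<in>{1..?n}. x $ \<pi> i = t}.
        (v (upper \<pi> i) - v (upper \<pi> (i + 1))) * x $ \<pi> i)"
    by (rule sum.group[symmetric]) auto
  then show ?thesis by (simp only: level)
qed

lemma choquet_eq:
  fixes v :: "'n::finite set \<Rightarrow> real"
  assumes "\<pi> \<in> perms" "x \<in> chain_region \<pi>"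
  shows "choquet v x = (\<Sum>i=1..CARD('n). (v (upper \<pi> i) - v (upper \<pi> (i + 1))) * x $ \<pi> i)"
proof -
  have "\<exists>!F. \<forall>\<pi>\<in>perms. \<forall>x\<in>chain_region \<pi>. F x =
      (\<Sum>i=1..CARD('n). (v (upper \<pi> i) - v (upper \<pi> (i + 1))) * x $ \<pi> i)"
  proof (rule ex1I)
    show "\<forall>\<pi>\<in>perms. \<forall>x\<in>chain_region \<pi>.
        (\<lambda>x. \<Sum>t\<in>range (($) x). t * (v {j. t \<le> x $ j} - v {j. t < x $ j})) x =
        (\<Sum>i=1..CARD('n). (v (upper \<pi> i) - v (upper \<pi> (i + 1))) * x $ \<pi> i)"
      by (intro ballI) (rule chain_sum_eq_levels[symmetric])
  next
    fix F assume F: "\<forall>\<pi>\<in>perms. \<forall>x\<in>chain_region \<pi>. F x =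
        (\<Sum>i=1..CARD('n). (v (upper \<pi> i) - v (upper \<pi> (i + 1))) * x $ \<pi> i)"
    show "F = (\<lambda>x. \<Sum>t\<in>range (($) x). t * (v {j. t \<le> x $ j} - v {j. t < x $ j}))"
    proof
      fix y :: "real ^ 'n"
      obtain \<rho> where "\<rho> \<in> perms" "y \<in> chain_region \<rho>" using chain_regions_cover by blast
      then show "F y = (\<Sum>t\<in>range (($) y). t * (v {j. t \<le> y $ j} - v {j. t < y $ j}))"
        using F chain_sum_eq_levels[of \<rho> y v] by simp
    qed
  qed
  from theI'[OF this] show ?thesis
    using assms unfolding choquet_def by blast
qed

lemma lovasz_extension_eq:
  fixes f :: "real ^ 'n::finite \<Rightarrow> real"
  assumes "\<pi> \<in> perms" "x \<in> chain_region \<pi>"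
  shows "lovasz_extension f x = f 0 + (\<Sum>i=1..CARD('n).
    (f (char_vec (upper \<pi> i)) - f (char_vec (upper \<pi> (i + 1)))) * x $ \<pi> i)"
proof -
  let ?v = "\<lambda>S. f (char_vec S)"
  have "\<exists>!F. \<forall>\<pi>\<in>perms. \<forall>x\<in>chain_region \<pi>. F x = f 0 + (\<Sum>i=1..CARD('n).
      (f (char_vec (upper \<pi> i)) - f (char_vec (upper \<pi> (i + 1)))) * x $ \<pi> i)"
  proof (rule ex1I)
    show "\<forall>\<pi>\<in>perms. \<forall>x\<in>chain_region \<pi>. (\<lambda>x. f 0 + choquet ?v x) x = f 0 + (\<Sum>i=1..CARD('n).
        (f (char_vec (upper \<pi> i)) - f (char_vec (upper \<pi> (i + 1)))) * x $ \<pi> i)"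
      using choquet_eq[of _ _ ?v] by simp
  next
    fix F assume F: "\<forall>\<pi>\<in>perms. \<forall>x\<in>chain_region \<pi>. F x = f 0 + (\<Sum>i=1..CARD('n).
        (f (char_vec (upper \<pi> i)) - f (char_vec (upper \<pi> (i + 1)))) * x $ \<pi> i)"
    show "F = (\<lambda>x. f 0 + choquet ?v x)"
    proof
      fix y :: "real ^ 'n"
      obtain \<rho> where "\<rho> \<in> perms" "y \<in> chain_region \<rho>" using chain_regions_cover by blast
      then show "F y = f 0 + choquet ?v y"
        using F choquet_eq[of \<rho> y ?v] by simp
    qed
  qed
  from theI'[OF this] show ?thesis
    using assms unfolding lovasz_extension_def by blast
qed

text \<open>The vertices of \<open>[0,1]\<^sup>n \<inter> chain_region \<pi>\<close> are the vectors \<open>char_vec (upper \<pi> k)\<close>, \<open>1 \<le> k \<le> n + 1\<close>.\<close>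

lemma lovasz_extension_vertex:
  fixes f :: "real ^ 'n::finite \<Rightarrow> real"
  shows "lovasz_extension f (char_vec S) = f (char_vec S)"
proof -
  obtain \<pi> where p: "\<pi> \<in> perms" "char_vec S \<in> chain_region \<pi>" using chain_regions_cover by blast
  let ?v = "\<lambda>S. f (char_vec S)" and ?x = "char_vec S :: real ^ 'n"
  have x: "?x $ j = (if j \<in> S then 1 else 0)" for j
    by (simp add: char_vec_def indicator_def)
  have z: "char_vec {} = (0 :: real ^ 'n)"
    by (simp add: char_vec_def vec_eq_iff)
  have "range (($) ?x) \<subseteq> {0, 1}" by (auto simp: x)
  then have "(\<Sum>t\<in>range (($) ?x). t * (?v {j. t \<le> ?x $ j} - ?v {j. t < ?x $ j})) =
      (\<Sum>t\<in>{0,1}. t * (?v {j. t \<le> ?x $ j} - ?v {j. t < ?x $ j}))"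
  proof (rule sum.mono_neutral_left[rotated])
    show "\<forall>t\<in>{0, 1} - range (($) ?x). t * (?v {j. t \<le> ?x $ j} - ?v {j. t < ?x $ j}) = 0"
    proof
      fix t assume t: "t \<in> {0, 1} - range (($) ?x)"
      then have "?x $ j \<noteq> t" for j by (metis DiffD2 rangeI)
      then have "{j. t \<le> ?x $ j} = {j. t < ?x $ j}" by (auto simp: less_le)
      then show "t * (?v {j. t \<le> ?x $ j} - ?v {j. t < ?x $ j}) = 0" by simp
    qed
  qed simp
  also have "\<dots> = f ?x - f 0"
  proof -
    have "{j. 1 \<le> ?x $ j} = S" "{j. 1 < ?x $ j} = {}" by (auto simp: x)
    then show ?thesis by (simp add: z)
  qed
  finally show ?thesis
    using lovasz_extension_eq[OF p, of f] chain_sum_eq_levels[OF p, of ?v] by simp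
qed

end

theory Submission
  imports Defs
begin

text \<open>
  On each cone \<open>chain_region \<pi>\<close> a Choquet integral is linear, which gives one direction.
  Conversely, comonotonic additivity together with continuity yields positive homogeneity along
  each ray, because every vector is comonotonic with its nonnegative multiples.  A comonotonic
  additive, positively homogeneous function is determined by its values at characteristic
  vectors: any vector is reduced to a constant one by repeatedly lowering its maximal entries to
  the second largest value, each time splitting off a comonotonic multiple of a characteristic
  vector.  Hence \<open>g\<close> coincides with its own Lovasz extension.
\<close>

section \<open>Comonotonic vectors and the two properties of \<open>h\<close>\<close>

definition comonotonic_additive :: "(real ^ 'n::finite \<Rightarrow> real) \<Rightarrow> bool" where
  "comonotonic_additive h \<longleftrightarrow> (\<forall>x x'. comonotonic x x' \<longrightarrow> h (x + x') = h x + h x')"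

definition pos_homogeneous :: "('a::real_vector \<Rightarrow> real) \<Rightarrow> bool" where
  "pos_homogeneous h \<longleftrightarrow> (\<forall>r>0. \<forall>x. h (r *\<^sub>R x) = r * h x)"

lemma comonotonic_additiveD:
  "comonotonic_additive h \<Longrightarrow> comonotonic x x' \<Longrightarrow> h (x + x') = h x + h x'"
  by (simp add: comonotonic_additive_def)

lemma pos_homogeneousD: "pos_homogeneous h \<Longrightarrow> r > 0 \<Longrightarrow> h (r *\<^sub>R x) = r * h x"
  by (simp add: pos_homogeneous_def)

text \<open>A permutation that sorts the entries of \<open>x\<close> also sorts every nondecreasing
  entrywise image of \<open>x\<close>. This is the source of all comonotonic pairs used
  below.\<close>

lemma comonotonic_mono_images:
  fixes x :: "real ^ 'n::finite"
  assumes "mono \<phi>" "mono \<psi>"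
  shows "comonotonic (\<chi> i. \<phi> (x $ i)) (\<chi> i. \<psi> (x $ i))"
proof -
  obtain \<pi> where "\<pi> \<in> perms" "x \<in> chain_region \<pi>"
    using chain_regions_cover by blast
  with assms show ?thesis
    unfolding comonotonic_def chain_region_def
    by (intro bexI[of _ \<pi>]) (auto simp: monotone_on_def)
qed

lemma comonotonic_scaleR:
  fixes x :: "real ^ 'n::finite"
  assumes "r \<ge> 0" "s \<ge> 0"
  shows "comonotonic (r *\<^sub>R x) (s *\<^sub>R x)"
proof -
  have "comonotonic (\<chi> i. r * x $ i) (\<chi> i. s * x $ i)"
    by (rule comonotonic_mono_images) (use assms in \<open>auto intro!: monoI mult_left_mono\<close>)
  moreover have "(\<chi> i. c * x $ i) = c *\<^sub>R x" for c
    by (simp add: vec_eq_iff)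
  ultimately show ?thesis by simp
qed

lemma char_vec_UNIV: "char_vec UNIV = (1 :: real ^ 'n::finite)"
  by (simp add: char_vec_def vec_eq_iff)

lemma char_vec_empty: "char_vec {} = (0 :: real ^ 'n::finite)"
  by (simp add: char_vec_def vec_eq_iff)

text \<open>Constant maps are monotone whatever their value, so unlike in
  \<open>comonotonic_scaleR\<close> the factors may be negative. This lets additivity relate a
  constant vector to its negative.\<close>

lemma comonotonic_const: "comonotonic (r *\<^sub>R (1 :: real ^ 'n::finite)) (s *\<^sub>R 1)"
proof -
  have "comonotonic (\<chi> i. r) (\<chi> i::'n. s)"
    using comonotonic_mono_images[of "\<lambda>_. r" "\<lambda>_. s" "0 :: real ^ 'n"] by (simp add: monoI)
  moreover have "(\<chi> i::'n. c) = c *\<^sub>R 1" for c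
    by (simp add: vec_eq_iff)
  ultimately show ?thesis by simp
qed

section \<open>From continuity to positive homogeneity\<close>

lemma comonotonic_additive_zero:
  fixes h :: "real ^ 'n::finite \<Rightarrow> real"
  assumes "comonotonic_additive h"
  shows "h 0 = 0"
  using comonotonic_additiveD[OF assms comonotonic_const[of 0 0]] by simp

text \<open>Cauchy's functional equation on a ray: additivity settles natural factors, then
  nonnegative rational ones, and continuity passes to real factors.\<close>

lemma pos_homogeneous_if_continuous:
  fixes h :: "real ^ 'n::finite \<Rightarrow> real"
  assumes add: "comonotonic_additive h" and cont: "continuous_on UNIV h"
  shows "pos_homogeneous h"
  unfolding pos_homogeneous_def
proof (intro allI impI)
  fix r :: real and x
  assume r: "r > 0"
  have nat_scale: "h (real m *\<^sub>R y) = real m * h y" for m y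
  proof (induction m)
    case 0
    show ?case using comonotonic_additive_zero[OF add] by simp
  next
    case (Suc m)
    have "comonotonic (real m *\<^sub>R y) y"
      using comonotonic_scaleR[of "real m" 1 y] by simp
    from comonotonic_additiveD[OF add this] Suc show ?case
      by (simp add: algebra_simps)
  qed
  \<comment> \<open>Rational approximations of \<open>r\<close> from below with error at most
    \<open>1 / Suc k\<close>. Since \<open>r > 0\<close>, the floor is nonnegative and
    \<open>nat\<close> does not truncate it.\<close>
  define q where "q k = real (nat \<lfloor>real (Suc k) * r\<rfloor>) / real (Suc k)" for k
  have hq: "h (q k *\<^sub>R x) = q k * h x" for k
  proof -
    \<comment> \<open>Clearing the denominator turns \<open>q k *\<^sub>R x\<close> into a natural
      multiple of \<open>x\<close>; evaluating \<open>h\<close> there in two ways and cancelling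
      \<open>Suc k\<close> gives the claim.\<close>
    have "real (Suc k) * q k = real (nat \<lfloor>real (Suc k) * r\<rfloor>)"
      by (simp add: q_def del: of_nat_Suc)
    then have "real (Suc k) * h (q k *\<^sub>R x) = real (Suc k) * (q k * h x)"
      using nat_scale[of "Suc k" "q k *\<^sub>R x"] nat_scale[of "nat \<lfloor>real (Suc k) * r\<rfloor>" x]
      by (simp del: of_nat_Suc flip: mult.assoc)
    then show ?thesis by (simp del: of_nat_Suc)
  qed
  have q_lim: "q \<longlonglongrightarrow> r"
  proof (rule tendsto_sandwich[of "\<lambda>k. r - inverse (real (Suc k))" _ _ "\<lambda>_. r"])
    have fl: "real (nat \<lfloor>real (Suc k) * r\<rfloor>) = of_int \<lfloor>real (Suc k) * r\<rfloor>" for k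
      using r by (intro of_nat_nat) simp
    show "\<forall>\<^sub>F k in sequentially. r - inverse (real (Suc k)) \<le> q k"
    proof (intro always_eventually allI)
      fix k
      have "real (Suc k) * r - 1 \<le> of_int \<lfloor>real (Suc k) * r\<rfloor>" by linarith
      then have "(real (Suc k) * r - 1) / real (Suc k) \<le> q k"
        unfolding q_def fl by (rule divide_right_mono) simp
      then show "r - inverse (real (Suc k)) \<le> q k"
        by (simp add: diff_divide_distrib inverse_eq_divide del: of_nat_Suc)
    qed
    show "\<forall>\<^sub>F k in sequentially. q k \<le> r"
    proof (intro always_eventually allI)
      fix k
      have "of_int \<lfloor>real (Suc k) * r\<rfloor> \<le> real (Suc k) * r" by linarith
      then show "q k \<le> r"
        unfolding q_def fl by (simp add: field_simps)
    qed
    show "(\<lambda>k. r - inverse (real (Suc k))) \<longlonglongrightarrow> r"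
      using tendsto_diff[OF tendsto_const LIMSEQ_inverse_real_of_nat] by simp
  qed simp
  have "isCont h (r *\<^sub>R x)"
    using cont by (simp add: continuous_on_eq_continuous_at)
  moreover have "(\<lambda>k. q k *\<^sub>R x) \<longlonglongrightarrow> r *\<^sub>R x"
    by (intro tendsto_intros q_lim)
  ultimately have "(\<lambda>k. h (q k *\<^sub>R x)) \<longlonglongrightarrow> h (r *\<^sub>R x)"
    by (rule isCont_tendsto_compose)
  moreover have "(\<lambda>k. h (q k *\<^sub>R x)) \<longlonglongrightarrow> r * h x"
    unfolding hq by (intro tendsto_intros q_lim)
  ultimately show "h (r *\<^sub>R x) = r * h x"
    by (rule LIMSEQ_unique)
qed

section \<open>Uniqueness from the values at characteristic vectors\<close>

lemma comonotonic_additive_eq_zero: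
  fixes h :: "real ^ 'n::finite \<Rightarrow> real"
  assumes add: "comonotonic_additive h" and hom: "pos_homogeneous h"
    and zero: "\<And>S. h (char_vec S) = 0"
  shows "h x = 0"
\<comment> \<open>The number of distinct entries drops because lowering the maximal entries merges
  the two largest values.\<close>
proof (induction "card (range (($) x))" arbitrary: x rule: less_induct)
  case less
  define M where "M = Max (range (($) x))"
  have M: "M \<in> range (($) x)" "\<And>i. x $ i \<le> M"
    unfolding M_def by (rule Max_in, simp_all)
  show ?case
  proof (cases "range (($) x) = {M}")
    case True
    then have "x $ i = M" for i by blast
    then have x: "x = M *\<^sub>R 1" by (simp add: vec_eq_iff)
    have pos: "h (r *\<^sub>R 1) = 0" if "r > 0" for r
      using pos_homogeneousD[OF hom that, of 1] zero[of UNIV] by (simp add: char_vec_UNIV)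
    \<comment> \<open>a constant vector is comonotonic with its negative, which reduces \<open>M < 0\<close> to \<open>M > 0\<close>\<close>
    have "h (M *\<^sub>R 1) + h ((- M) *\<^sub>R 1) = 0"
      using comonotonic_additiveD[OF add comonotonic_const[of M "- M"]]
        comonotonic_additive_zero[OF add] by simp
    with pos[of M] pos[of "- M"] show ?thesis
      unfolding x using comonotonic_additive_zero[OF add] by (cases "M = 0") force+
  next
    case False
    define R where "R = range (($) x) - {M}"
    define M' where "M' = Max R"
    have R: "finite R" "R \<noteq> {}" using False M(1) by (auto simp: R_def)
    then have M': "M' \<in> R" "\<And>t. t \<in> R \<Longrightarrow> t \<le> M'" by (simp_all add: M'_def)
    have lt: "M' < M" using M'(1) M(2) unfolding R_def by (auto simp: less_le)
    have le: "x $ i \<le> M'" if "x $ i \<noteq> M" for i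
      using that by (intro M'(2)) (simp add: R_def)
    \<comment> \<open>\<open>y\<close> caps \<open>x\<close> at the second largest value
      \<open>M'\<close>; \<open>z\<close> is the layer cut off, of height
      \<open>M - M' > 0\<close>.\<close>
    define y where "y = (\<chi> i. min (x $ i) M')"
    define z where "z = (M - M') *\<^sub>R (char_vec {i. x $ i = M} :: real ^ 'n)"
    have "x $ i = y $ i + z $ i" for i
      using le[of i] lt by (cases "x $ i = M") (simp_all add: y_def z_def char_vec_def)
    then have x: "x = y + z" by (simp add: vec_eq_iff)
    \<comment> \<open>The test \<open>x $ i = M\<close> is not monotone in the entry, but as
      \<open>M\<close> is the maximum it can be replaced by a threshold, which is.\<close>
    have z: "z = (\<chi> i. if x $ i \<ge> M then M - M' else 0)"
      using M(2) by (auto simp: z_def vec_eq_iff char_vec_def indicator_def intro: antisym)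
    have "comonotonic y z"
      unfolding y_def z
      by (rule comonotonic_mono_images) (use lt in \<open>auto intro!: monoI\<close>)
    then have "h x = h y + h z"
      unfolding x by (rule comonotonic_additiveD[OF add])
    moreover have "h z = 0"
      using pos_homogeneousD[OF hom, of "M - M'"] lt zero by (simp add: z_def)
    moreover have "h y = 0"
    proof (rule less)
      have "y $ i \<in> R" for i
      proof (cases "x $ i = M")
        case True
        then show ?thesis using lt M'(1) by (simp add: y_def)
      next
        case False
        then show ?thesis using le[of i] by (simp add: y_def R_def)
      qed
      then have "range (($) y) \<subseteq> R" by blast
      also have "R \<subset> range (($) x)" using M(1) unfolding R_def by blast
      finally have "range (($) y) \<subset> range (($) x)" .
      then show "card (range (($) y)) < card (range (($) x))"
        by (simp add: psubset_card_mono)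
    qed
    ultimately show ?thesis by simp
  qed
qed

text \<open>Both properties pass to differences, so uniqueness reduces to the vanishing of
  \<open>h - k\<close>.\<close>

lemma comonotonic_additive_eqI:
  fixes h k :: "real ^ 'n::finite \<Rightarrow> real"
  assumes "comonotonic_additive h" "pos_homogeneous h"
    and "comonotonic_additive k" "pos_homogeneous k"
    and "\<And>S. h (char_vec S) = k (char_vec S)"
  shows "h = k"
proof
  fix x
  have "h x - k x = 0"
    by (rule comonotonic_additive_eq_zero[of "\<lambda>x. h x - k x"])
      (use assms in \<open>auto simp: comonotonic_additive_def pos_homogeneous_def algebra_simps\<close>)
  then show "h x = k x" by simp
qed

section \<open>Choquet integrals and Lovasz extensions\<close>

lemma chain_region_add:
  "x \<in> chain_region \<pi> \<Longrightarrow> y \<in> chain_region \<pi> \<Longrightarrow> x + y \<in> chain_region \<pi>"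
  unfolding chain_region_def by (auto simp: monotone_on_def intro!: add_mono)

lemma chain_region_scaleR:
  "x \<in> chain_region \<pi> \<Longrightarrow> r \<ge> 0 \<Longrightarrow> r *\<^sub>R x \<in> chain_region \<pi>"
  unfolding chain_region_def by (auto simp: monotone_on_def intro!: mult_left_mono)

lemma comonotonic_additive_choquet: "comonotonic_additive (choquet v)"
  unfolding comonotonic_additive_def comonotonic_def
proof (intro allI impI, elim bexE conjE)
  fix x y and \<pi> :: "nat \<Rightarrow> 'a"
  assume p: "\<pi> \<in> perms" and xy: "x \<in> chain_region \<pi>" "y \<in> chain_region \<pi>"
  show "choquet v (x + y) = choquet v x + choquet v y"
    by (simp add: choquet_eq[OF p] xy chain_region_add distrib_left sum.distrib)
qed

lemma pos_homogeneous_choquet: "pos_homogeneous (choquet v)"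
  unfolding pos_homogeneous_def
proof (intro allI impI)
  fix r :: real and x :: "real ^ 'a"
  assume r: "r > 0"
  obtain \<pi> where "\<pi> \<in> perms" "x \<in> chain_region \<pi>"
    using chain_regions_cover by blast
  with r show "choquet v (r *\<^sub>R x) = r * choquet v x"
    by (simp add: choquet_eq chain_region_scaleR sum_distrib_left mult.left_commute)
qed

text \<open>Subtracting \<open>f 0\<close> makes the set function a signed capacity and leaves the
  differences along each chain unchanged.\<close>

lemma lovasz_extension_eq_choquet:
  "lovasz_extension f x = f 0 + choquet (\<lambda>S. f (char_vec S) - f 0) x"
proof -
  obtain \<pi> where "\<pi> \<in> perms" "x \<in> chain_region \<pi>"
    using chain_regions_cover by blast
  then show ?thesis
    by (simp add: lovasz_extension_eq choquet_eq)
qed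

lemma lovasz_extension_zero: "lovasz_extension f 0 = f 0"
  using lovasz_extension_vertex[of f "{}"] by (simp add: char_vec_empty)

theorem theorem3p2:
  fixes g h :: "real ^ 'n::finite \<Rightarrow> real"
  assumes "h = (\<lambda>x. g x - g 0)"
  shows "(is_lovasz_extension g \<longleftrightarrow>
           (\<forall>x x'. comonotonic x x' \<longrightarrow> h (x + x') = h x + h x') \<and>
           (continuous_on UNIV h \<or> (\<forall>r>0. \<forall>x. h (r *\<^sub>R x) = r * h x)))
       \<and> (is_lovasz_extension g \<and> g 0 = 0 \<longrightarrow> is_signed_choquet_integral g)"
proof -
  have "comonotonic_additive h \<and> pos_homogeneous h" if lov: "is_lovasz_extension g"
  proof -
    obtain f where g: "g = lovasz_extension f"
      using lov by (auto simp: is_lovasz_extension_def)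
    have "h = choquet (\<lambda>S. f (char_vec S) - f 0)"
      unfolding assms g lovasz_extension_zero by (simp add: fun_eq_iff lovasz_extension_eq_choquet)
    then show ?thesis
      by (simp add: comonotonic_additive_choquet pos_homogeneous_choquet)
  qed
  moreover have "is_lovasz_extension g"
    if add: "comonotonic_additive h" and "continuous_on UNIV h \<or> pos_homogeneous h"
  proof -
    have hom: "pos_homogeneous h"
      using that pos_homogeneous_if_continuous by blast
    \<comment> \<open>The candidate is built from the values of \<open>g\<close> itself:
      \<open>lovasz_extension g\<close> interpolates \<open>g\<close> at characteristic vectors, so
      \<open>h\<close> and this integral agree there and uniqueness applies.\<close>
    have "h = choquet (\<lambda>S. g (char_vec S) - g 0)"
    proof (rule comonotonic_additive_eqI[OF add hom comonotonic_additive_choquet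
          pos_homogeneous_choquet])
      show "h (char_vec S) = choquet (\<lambda>S. g (char_vec S) - g 0) (char_vec S)" for S
        using lovasz_extension_vertex[of g S] by (simp add: assms lovasz_extension_eq_choquet)
    qed
    then have "lovasz_extension g x = g 0 + h x" for x
      unfolding lovasz_extension_eq_choquet by simp
    then have "g = lovasz_extension g"
      by (simp add: assms fun_eq_iff)
    then show ?thesis
      unfolding is_lovasz_extension_def by blast
  qed
  moreover have "is_signed_choquet_integral g" if lov: "is_lovasz_extension g" and "g 0 = 0"
  proof -
    obtain f where g: "g = lovasz_extension f"
      using lov by (auto simp: is_lovasz_extension_def)
    \<comment> \<open>The extension takes the value \<open>f 0\<close> at the origin, so here the
      shift by \<open>f 0\<close> disappears and \<open>f\<close> itself induces the
      capacity.\<close>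
    with \<open>g 0 = 0\<close> have "f 0 = 0" by (simp add: lovasz_extension_zero)
    then have "g = choquet (\<lambda>S. f (char_vec S))"
      unfolding g by (simp add: fun_eq_iff lovasz_extension_eq_choquet)
    moreover have "signed_capacity (\<lambda>S. f (char_vec S))"
      using \<open>f 0 = 0\<close> by (simp add: signed_capacity_def char_vec_empty)
    ultimately show ?thesis
      unfolding is_signed_choquet_integral_def by blast
  qed
  ultimately show ?thesis
    unfolding comonotonic_additive_def pos_homogeneous_def by blast
qed

end
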